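(* Let $V$ be a value quantale, let $X$ be a separated $V$-space with uniformly vanishing asymmetry, let $\hat{X}$ be the $V$-space of all proper minimal Cauchy filters on $X$, and let $\iota:X\to\hat{X}$, $\iota(x)=\mathcal{F}_{x}$, be the canonical embedding. Then for every Cauchy complete $V$-space $Y$ with uniformly vanishing asymmetry and every uniformly continuous function $f:X\to Y$ there exists a unique uniformly continuous function $F:\hat{X}\to Y$ extending $f$, i.e. with $F\circ\iota=f$.
   Context: A value quantale is a pair $(V,+)$ where $V$ is a complete lattice with bottom $0$ and top $\infty$, and $+$ is an associative commutative binary operation on $V$ such that $x+0=x$, $x=\bigwedge\{y\in V\mid y\succ x\}$, $x+\bigwedge S=\bigwedge\{x+s\mid s\in S\}$, and $a\wedge b\succ 0$ whenever $a\succ0$ and $b\succ0$ (for all $x,a,b\in V$, $S\subseteq V$). Here $a\succ b$ ("$a$ is well above $b$") means: for every $S\subseteq V$ with $b\ge\bigwedge S$ there is $s\in S$ with $a\ge s$. Writing "$\varepsilon\succ0$" presumes $\varepsilon\in V$. A $V$-space is a set $X$ with a function $d:X\times X\to V$ with $d(x,x)=0$ and $d(x,z)\le d(x,y)+d(y,z)$ for all $x,y,z\in X$. It is separated if $d(x,y)=0=d(y,x)$ implies $x=y$. It has uniformly vanishing asymmetry if for all $\varepsilon\succ0$ there is $\delta\succ0$ such that $d(y,x)\le\delta$ implies $d(x,y)\le\varepsilon$, for all $x,y\in X$. A function $f:X\to Y$ between $V$-spaces is uniformly continuous if for all $\varepsilon\succ0$ there is $\delta\succ0$ such that $d(x_1,x_2)\le\delta$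 implies $d(f(x_1),f(x_2))\le\varepsilon$. For $\varepsilon\succ0$ put $\mathbf{B}_{\varepsilon}(x)=\{y\in X\mid d(x,y)\le\varepsilon\}$. A filter on $X$ is a non-empty collection $\mathcal{F}\subseteq\mathcal{P}(X)$ closed under supersets and binary intersections; $\emptyset\in\mathcal{F}$ is allowed, and $\mathcal{F}$ is proper if $\mathcal{F}\neq\mathcal{P}(X)$. A filter $\mathcal{F}$ is Cauchy if for all $\varepsilon\succ0$ there is $x\in X$ with $\mathbf{B}_{\varepsilon}(x)\in\mathcal{F}$. A minimal Cauchy filter is a Cauchy filter that does not strictly contain another Cauchy filter. A filter $\mathcal{F}$ converges to $x$ if $\mathbf{B}_{\varepsilon}(x)\in\mathcal{F}$ for all $\varepsilon\succ0$. A $V$-space is Cauchy complete if every proper Cauchy filter on it converges to some point. The distance on $\hat{X}$ is $d(\mathcal{F},\mathcal{G})=\bigvee_{F\in\mathcal{F},\,G\in\mathcal{G}}\ \bigwedge_{s\in F,\,t\in G}d(s,t)$. For $x\in X$, $\mathcal{F}_{x}$ is the filter generated by (the least filter containing) $\{\mathbf{B}_{\varepsilon}(x)\mid\varepsilon\succ0\}$; when $X$ has uniformly vanishing asymmetry it is a proper minimal Cauchy filter, i.e. $\mathcal{F}_{x}\in\hat{X}$.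
   Formalization: Existence of the extension is proved for every Y as stated, but uniqueness only when Y is also separated; without this it fails, e.g. for X=(0,1] with the usual metric and Y={a,b} with d=0. *)

theory Defs
  imports Complex_Main "HOL-Library.FuncSet"
begin

definition (in complete_lattice) well_above :: "'a \<Rightarrow> 'a \<Rightarrow> bool"  (infix "\<succ>" 50)
  where "a \<succ> b \<longleftrightarrow> (\<forall>S. Inf S \<le> b \<longrightarrow> (\<exists>s\<in>S. s \<le> a))"

class value_quantale = complete_lattice + comm_monoid_add +
  assumes zero_eq_bot: "0 = bot"
    and Inf_well_above: "x = Inf {y. y \<succ> x}"
    and add_Inf: "x + Inf S = Inf {x + s |s. s \<in> S}"
    and inf_well_above_zero: "a \<succ> 0 \<Longrightarrow> b \<succ> 0 \<Longrightarrow> inf a b \<succ> 0"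

text \<open>
  Spaces are given by a carrier set, which may be empty, and a distance function whose
  values outside the carrier are irrelevant.
\<close>

definition V_space :: "'a set \<Rightarrow> ('a \<Rightarrow> 'a \<Rightarrow> 'v::value_quantale) \<Rightarrow> bool"
  where "V_space X d \<longleftrightarrow>
    (\<forall>x\<in>X. d x x = 0) \<and> (\<forall>x\<in>X. \<forall>y\<in>X. \<forall>z\<in>X. d x z \<le> d x y + d y z)"

definition V_separated :: "'a set \<Rightarrow> ('a \<Rightarrow> 'a \<Rightarrow> 'v::value_quantale) \<Rightarrow> bool"
  where "V_separated X d \<longleftrightarrow> (\<forall>x\<in>X. \<forall>y\<in>X. d x y = 0 \<and> d y x = 0 \<longrightarrow> x = y)"

definition uniformly_vanishing_asymmetry ::
    "'a set \<Rightarrow> ('a \<Rightarrow> 'a \<Rightarrow> 'v::value_quantale) \<Rightarrow> bool"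
  where "uniformly_vanishing_asymmetry X d \<longleftrightarrow>
    (\<forall>\<epsilon>. \<epsilon> \<succ> 0 \<longrightarrow> (\<exists>\<delta>. \<delta> \<succ> 0 \<and> (\<forall>x\<in>X. \<forall>y\<in>X. d y x \<le> \<delta> \<longrightarrow> d x y \<le> \<epsilon>)))"

definition V_uniformly_continuous ::
    "'a set \<Rightarrow> ('a \<Rightarrow> 'a \<Rightarrow> 'v::value_quantale) \<Rightarrow> ('b \<Rightarrow> 'b \<Rightarrow> 'v) \<Rightarrow> ('a \<Rightarrow> 'b) \<Rightarrow> bool"
  where "V_uniformly_continuous X dX dY f \<longleftrightarrow>
    (\<forall>\<epsilon>. \<epsilon> \<succ> 0 \<longrightarrow> (\<exists>\<delta>. \<delta> \<succ> 0 \<and>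
      (\<forall>x\<^sub>1\<in>X. \<forall>x\<^sub>2\<in>X. dX x\<^sub>1 x\<^sub>2 \<le> \<delta> \<longrightarrow> dY (f x\<^sub>1) (f x\<^sub>2) \<le> \<epsilon>)))"

definition V_ball :: "'a set \<Rightarrow> ('a \<Rightarrow> 'a \<Rightarrow> 'v::value_quantale) \<Rightarrow> 'v \<Rightarrow> 'a \<Rightarrow> 'a set"
  where "V_ball X d \<epsilon> x = {y \<in> X. d x y \<le> \<epsilon>}"

text \<open>
  A filter on a carrier \<open>X\<close>, viewed as a collection of subsets of \<open>X\<close>, is a library filter
  \<open>F \<le> principal X\<close>; its members are the following sets. The improper filter is \<open>bot\<close>.
  The library order is opposite to inclusion of collections: \<open>F < G\<close> says that the
  collection \<open>F\<close> strictly contains the collection \<open>G\<close>.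
\<close>

definition filter_members :: "'a set \<Rightarrow> 'a filter \<Rightarrow> 'a set set"
  where "filter_members X F = {A. A \<subseteq> X \<and> eventually (\<lambda>x. x \<in> A) F}"

lemma filter_le_iff_members:
  assumes "F \<le> principal X" "G \<le> principal X"
  shows "F \<le> G \<longleftrightarrow> filter_members X G \<subseteq> filter_members X F"
proof
  assume "F \<le> G"
  then show "filter_members X G \<subseteq> filter_members X F"
    by (auto simp: filter_members_def le_filter_def)
next
  assume sub: "filter_members X G \<subseteq> filter_members X F"
  show "F \<le> G"
  proof (rule filter_leI)
    fix P assume "eventually P G"
    moreover have "eventually (\<lambda>x. x \<in> X) G"
      using assms(2) by (simp add: le_principal)
    ultimately have "{x \<in> X. P x} \<in> filter_members X G"
      by (auto simp: filter_members_def elim: eventually_elim2)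
    then have "eventually (\<lambda>x. x \<in> {x \<in> X. P x}) F"
      using sub unfolding filter_members_def by blast
    then show "eventually P F"
      by (rule eventually_mono) simp
  qed
qed

definition V_Cauchy :: "'a set \<Rightarrow> ('a \<Rightarrow> 'a \<Rightarrow> 'v::value_quantale) \<Rightarrow> 'a filter \<Rightarrow> bool"
  where "V_Cauchy X d F \<longleftrightarrow> F \<le> principal X \<and>
    (\<forall>\<epsilon>. \<epsilon> \<succ> 0 \<longrightarrow> (\<exists>x\<in>X. V_ball X d \<epsilon> x \<in> filter_members X F))"

definition V_minimal_Cauchy ::
    "'a set \<Rightarrow> ('a \<Rightarrow> 'a \<Rightarrow> 'v::value_quantale) \<Rightarrow> 'a filter \<Rightarrow> bool"
  where "V_minimal_Cauchy X d F \<longleftrightarrow> V_Cauchy X d F \<and> \<not> (\<exists>G. V_Cauchy X d G \<and> F < G)"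

definition V_converges ::
    "'a set \<Rightarrow> ('a \<Rightarrow> 'a \<Rightarrow> 'v::value_quantale) \<Rightarrow> 'a filter \<Rightarrow> 'a \<Rightarrow> bool"
  where "V_converges X d F x \<longleftrightarrow> (\<forall>\<epsilon>. \<epsilon> \<succ> 0 \<longrightarrow> V_ball X d \<epsilon> x \<in> filter_members X F)"

definition V_Cauchy_complete :: "'a set \<Rightarrow> ('a \<Rightarrow> 'a \<Rightarrow> 'v::value_quantale) \<Rightarrow> bool"
  where "V_Cauchy_complete X d \<longleftrightarrow>
    (\<forall>F. V_Cauchy X d F \<and> F \<noteq> bot \<longrightarrow> (\<exists>x\<in>X. V_converges X d F x))"

definition V_completion :: "'a set \<Rightarrow> ('a \<Rightarrow> 'a \<Rightarrow> 'v::value_quantale) \<Rightarrow> 'a filter set"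
  where "V_completion X d = {F. V_minimal_Cauchy X d F \<and> F \<noteq> bot}"

definition V_completion_dist ::
    "'a set \<Rightarrow> ('a \<Rightarrow> 'a \<Rightarrow> 'v::value_quantale) \<Rightarrow> 'a filter \<Rightarrow> 'a filter \<Rightarrow> 'v"
  where "V_completion_dist X d F G =
    (SUP (A, B) \<in> filter_members X F \<times> filter_members X G. INF (s, t) \<in> A \<times> B. d s t)"

text \<open>
  The filter on \<open>X\<close> generated by the balls around \<open>x\<close>. The explicit \<open>principal X\<close> matters
  only for a one-element \<open>V\<close>, where no \<open>\<epsilon> \<succ> 0\<close> exists.
\<close>

definition V_embedding ::
    "'a set \<Rightarrow> ('a \<Rightarrow> 'a \<Rightarrow> 'v::value_quantale) \<Rightarrow> 'a \<Rightarrow> 'a filter"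
  where "V_embedding X d x =
    inf (principal X) (INF \<epsilon>\<in>{\<epsilon>. \<epsilon> \<succ> 0}. principal (V_ball X d \<epsilon> x))"

lemma le_V_embedding_iff:
  "F \<le> V_embedding X d x \<longleftrightarrow> F \<le> principal X \<and> V_converges X d F x"
  by (auto simp: V_embedding_def V_converges_def filter_members_def V_ball_def
      le_INF_iff le_principal)

end

theory Submission imports Defs begin

text \<open>
  Push a point \<open>G\<close> of the completion forward along \<open>f\<close>. Uniform continuity makes \<open>filtermap f G\<close>
  a proper Cauchy filter on \<open>Y\<close> (\<open>V_Cauchy_filtermap\<close>), so it has a limit, and \<open>F G\<close> is chosen to
  be such a limit. Any such choice is uniformly continuous
  (\<open>V_uniformly_continuous_limit_choice\<close>): if the distance from \<open>G\<close> to \<open>H\<close> is small, then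
  arbitrarily small members of \<open>G\<close> and \<open>H\<close> contain points \<open>s\<close> and \<open>t\<close> with \<open>dX s t\<close> small, and
  \<open>F G\<close>, \<open>f s\<close>, \<open>f t\<close>, \<open>F H\<close> is a chain with small steps. By continuity \<open>f x\<close> is itself one of the
  limits of the image of the ball filter of \<open>x\<close>. The limit at the ball filter of \<open>x\<close> can therefore
  be chosen to be \<open>f x\<close>, unambiguously because distinct points of a separated space have
  distinct ball filters; this makes \<open>F\<close> an extension even if \<open>Y\<close> is not separated.

  For uniqueness, the points of \<open>X\<close> are dense: \<open>G\<close> is close to the ball filter of every point of a
  small member of \<open>G\<close> (\<open>V_completion_dist_to_embedding\<close>). Hence every uniformly continuous
  extension has at \<open>G\<close> a limit of \<open>filtermap f G\<close>, and limits are unique if \<open>Y\<close> is separated.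

  The arguments with \<open>\<epsilon>\<close> and \<open>\<delta>\<close> need two facts about a value quantale: an \<open>\<epsilon> \<succ> 0\<close> can be
  halved (\<open>well_above_zero_half\<close>), and it is well above some \<open>\<delta> \<succ> 0\<close>
  (\<open>well_above_zero_interpolate\<close>). The latter turns the bound by \<open>\<delta>\<close> on an infimum of distances
  into a bound by \<open>\<epsilon>\<close> on one of them.
\<close>

section \<open>Value quantales\<close>

lemma vq_add_left_mono:
  fixes a b c :: "'v::value_quantale"
  assumes "a \<le> b"
  shows "c + a \<le> c + b"
proof -
  have "c + a = c + Inf {a, b}"
    using assms by (simp add: inf_absorb1)
  also have "\<dots> = Inf {c + s |s. s \<in> {a, b}}"
    by (rule add_Inf)
  also have "\<dots> \<le> c + b"
    by (rule Inf_lower) auto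
  finally show ?thesis .
qed

lemma vq_add_mono:
  fixes a b c e :: "'v::value_quantale"
  assumes "a \<le> b" "c \<le> e"
  shows "a + c \<le> b + e"
  using vq_add_left_mono[OF assms(1), of c] vq_add_left_mono[OF assms(2), of b]
  by (simp add: add.commute order_trans)

lemma vq_zero_le [simp]: "(0 :: 'v::value_quantale) \<le> a"
  by (simp add: zero_eq_bot)

lemma Inf_well_above_zero: "Inf {\<epsilon>. \<epsilon> \<succ> 0} = (0 :: 'v::value_quantale)"
  by (rule Inf_well_above[symmetric])

lemma well_aboveD: "\<epsilon> \<succ> b \<Longrightarrow> Inf S \<le> b \<Longrightarrow> \<exists>s\<in>S. s \<le> \<epsilon>"
  by (simp add: well_above_def)

lemma well_above_upward: "a \<succ> b \<Longrightarrow> a \<le> c \<Longrightarrow> c \<succ> b"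
  unfolding well_above_def by (meson order_trans)

lemma eq_zero_if_le_well_above:
  fixes a :: "'v::value_quantale"
  assumes "\<And>\<epsilon>. \<epsilon> \<succ> 0 \<Longrightarrow> a \<le> \<epsilon>"
  shows "a = 0"
proof (rule antisym)
  have "a \<le> Inf {\<epsilon>. \<epsilon> \<succ> 0}"
    using assms by (auto intro: Inf_greatest)
  then show "a \<le> 0"
    by (simp only: Inf_well_above_zero)
qed simp

text \<open>
  Since addition commutes with infima, the sums of two elements well above \<open>0\<close> have infimum
  \<open>0 + 0 = 0\<close>, so one of them lies below \<open>\<epsilon>\<close>.
\<close>

lemma well_above_zero_half:
  fixes \<epsilon> :: "'v::value_quantale"
  assumes "\<epsilon> \<succ> 0"
  obtains \<delta> where "\<delta> \<succ> 0" "\<delta> + \<delta> \<le> \<epsilon>"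
proof -
  let ?P = "{\<epsilon>::'v. \<epsilon> \<succ> 0}"
  let ?S = "{a + b |a b. a \<in> ?P \<and> b \<in> ?P}"
  have "Inf ?S \<le> a" if "a \<in> ?P" for a
  proof -
    have "Inf ?S \<le> Inf {a + b |b. b \<in> ?P}"
      using that by (intro Inf_superset_mono) blast
    also have "\<dots> = a"
      by (simp only: add_Inf[symmetric] Inf_well_above_zero add_0_right)
    finally show ?thesis .
  qed
  then have "Inf ?S \<le> Inf ?P"
    by (rule Inf_greatest)
  then obtain a b where "a \<succ> 0" "b \<succ> 0" "a + b \<le> \<epsilon>"
    using well_aboveD[OF assms, of ?S] unfolding Inf_well_above_zero by blast
  moreover have "inf a b + inf a b \<le> a + b"
    by (intro vq_add_mono) auto
  ultimately have "inf a b \<succ> 0" "inf a b + inf a b \<le> \<epsilon>"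
    by (auto intro: inf_well_above_zero order_trans)
  then show thesis
    by (rule that)
qed

lemma well_above_zero_third:
  fixes \<epsilon> :: "'v::value_quantale"
  assumes "\<epsilon> \<succ> 0"
  obtains \<delta> where "\<delta> \<succ> 0" "\<delta> + (\<delta> + \<delta>) \<le> \<epsilon>"
proof -
  obtain \<eta> where \<eta>: "\<eta> \<succ> 0" "\<eta> + \<eta> \<le> \<epsilon>"
    using well_above_zero_half[OF assms] .
  obtain \<delta> where \<delta>: "\<delta> \<succ> 0" "\<delta> + \<delta> \<le> \<eta>"
    using well_above_zero_half[OF \<eta>(1)] .
  have "\<delta> \<le> \<eta>"
    using vq_add_left_mono[OF vq_zero_le, of \<delta> \<delta>] \<delta>(2) by simp
  then have "\<delta> + (\<delta> + \<delta>) \<le> \<epsilon>"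
    using \<delta>(2) \<eta>(2) by (blast intro: order_trans vq_add_mono)
  then show thesis
    using \<delta>(1) that by blast
qed

text \<open>
  Every \<open>y \<succ> 0\<close> is the infimum of the elements well above it. So the elements that are well above
  some \<open>y \<succ> 0\<close> have infimum \<open>0\<close>, and one of them lies below \<open>\<epsilon>\<close>.
\<close>

lemma well_above_zero_interpolate:
  fixes \<epsilon> :: "'v::value_quantale"
  assumes "\<epsilon> \<succ> 0"
  obtains \<delta> where "\<delta> \<succ> 0" "\<epsilon> \<succ> \<delta>"
proof -
  let ?P = "{\<epsilon>::'v. \<epsilon> \<succ> 0}"
  let ?S = "{z. \<exists>y\<in>?P. z \<succ> y}"
  have "Inf ?S \<le> y" if "y \<in> ?P" for y
  proof -
    have "Inf ?S \<le> Inf {z. z \<succ> y}"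
      using that by (intro Inf_superset_mono) blast
    also have "\<dots> = y"
      by (rule Inf_well_above[symmetric])
    finally show ?thesis .
  qed
  then have "Inf ?S \<le> Inf ?P"
    by (rule Inf_greatest)
  then obtain z y where "y \<succ> 0" "z \<succ> y" "z \<le> \<epsilon>"
    using well_aboveD[OF assms, of ?S] unfolding Inf_well_above_zero by blast
  then show thesis
    using that well_above_upward by blast
qed

section \<open>Cauchy filters and limits\<close>

lemma V_spaceD:
  assumes "V_space X d"
  shows "x \<in> X \<Longrightarrow> d x x = 0"
    and "x \<in> X \<Longrightarrow> y \<in> X \<Longrightarrow> z \<in> X \<Longrightarrow> d x z \<le> d x y + d y z"
  using assms by (auto simp: V_space_def)

lemma uniformly_vanishing_asymmetryE:
  assumes "uniformly_vanishing_asymmetry X d" "\<epsilon> \<succ> 0"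
  obtains \<delta> where "\<delta> \<succ> 0" "\<And>x y. x \<in> X \<Longrightarrow> y \<in> X \<Longrightarrow> d y x \<le> \<delta> \<Longrightarrow> d x y \<le> \<epsilon>"
  using assms unfolding uniformly_vanishing_asymmetry_def by blast

lemma V_uniformly_continuousE:
  assumes "V_uniformly_continuous X dX dY f" "\<epsilon> \<succ> 0"
  obtains \<delta> where "\<delta> \<succ> 0"
    "\<And>x y. x \<in> X \<Longrightarrow> y \<in> X \<Longrightarrow> dX x y \<le> \<delta> \<Longrightarrow> dY (f x) (f y) \<le> \<epsilon>"
  using assms unfolding V_uniformly_continuous_def by blast

lemma V_ball_in_filter_members_iff:
  "V_ball X d \<epsilon> x \<in> filter_members X F \<longleftrightarrow> (\<forall>\<^sub>F y in F. y \<in> X \<and> d x y \<le> \<epsilon>)"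
  by (auto simp: V_ball_def filter_members_def)

lemma V_converges_iff:
  "V_converges X d F x \<longleftrightarrow> (\<forall>\<epsilon>. \<epsilon> \<succ> 0 \<longrightarrow> (\<forall>\<^sub>F y in F. y \<in> X \<and> d x y \<le> \<epsilon>))"
  by (simp add: V_converges_def V_ball_in_filter_members_iff)

text \<open>
  Two points of a ball are close to each other only if the distance from a point of the ball back
  to its centre is small too, which is what vanishing asymmetry provides.
\<close>

lemma V_Cauchy_small_member:
  assumes X: "V_space X d" "uniformly_vanishing_asymmetry X d"
    and F: "V_Cauchy X d F" and "\<epsilon> \<succ> 0"
  obtains A where "A \<in> filter_members X F" "\<And>s t. s \<in> A \<Longrightarrow> t \<in> A \<Longrightarrow> d s t \<le> \<epsilon>"
proof -
  obtain \<eta> where \<eta>: "\<eta> \<succ> 0" "\<eta> + \<eta> \<le> \<epsilon>"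
    using well_above_zero_half[OF \<open>\<epsilon> \<succ> 0\<close>] .
  obtain \<delta> where \<delta>: "\<delta> \<succ> 0" "\<And>x y. x \<in> X \<Longrightarrow> y \<in> X \<Longrightarrow> d y x \<le> \<delta> \<Longrightarrow> d x y \<le> \<eta>"
    using uniformly_vanishing_asymmetryE[OF X(2) \<eta>(1)] by blast
  obtain x where x: "x \<in> X" "V_ball X d (inf \<eta> \<delta>) x \<in> filter_members X F"
    using F inf_well_above_zero[OF \<eta>(1) \<delta>(1)] by (auto simp: V_Cauchy_def)
  have "d s t \<le> \<epsilon>" if "s \<in> V_ball X d (inf \<eta> \<delta>) x" "t \<in> V_ball X d (inf \<eta> \<delta>) x" for s t
  proof -
    have "s \<in> X" "t \<in> X" "d x s \<le> \<delta>" "d x t \<le> \<eta>"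
      using that by (auto simp: V_ball_def)
    then have "d s t \<le> d s x + d x t" "d s x + d x t \<le> \<eta> + \<eta>"
      using V_spaceD(2)[OF X(1)] x(1) \<delta>(2) by (auto intro: vq_add_mono)
    then show ?thesis
      using \<eta>(2) by (meson order_trans)
  qed
  then show thesis
    using x(2) that by blast
qed

lemma V_Cauchy_filtermap:
  fixes dX :: "'a \<Rightarrow> 'a \<Rightarrow> 'v::value_quantale" and dY :: "'b \<Rightarrow> 'b \<Rightarrow> 'v"
  assumes F: "V_Cauchy X dX F" and f: "f \<in> X \<rightarrow> Y" "V_uniformly_continuous X dX dY f"
  shows "V_Cauchy Y dY (filtermap f F)"
  unfolding V_Cauchy_def
proof (intro conjI allI impI)
  show "filtermap f F \<le> principal Y"
    using F f(1) by (auto simp: V_Cauchy_def le_principal eventually_filtermap elim: eventually_mono)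
next
  fix \<epsilon> :: 'v assume "\<epsilon> \<succ> 0"
  then obtain \<delta> where \<delta>: "\<delta> \<succ> 0"
    "\<And>x y. x \<in> X \<Longrightarrow> y \<in> X \<Longrightarrow> dX x y \<le> \<delta> \<Longrightarrow> dY (f x) (f y) \<le> \<epsilon>"
    using V_uniformly_continuousE[OF f(2)] by blast
  obtain x where x: "x \<in> X" "\<forall>\<^sub>F y in F. y \<in> X \<and> dX x y \<le> \<delta>"
    using F \<delta>(1) by (auto simp: V_Cauchy_def V_ball_in_filter_members_iff)
  have "\<forall>\<^sub>F y in F. f y \<in> Y \<and> dY (f x) (f y) \<le> \<epsilon>"
    using x(2) by (rule eventually_mono) (use x(1) f(1) \<delta>(2) in auto)
  then show "\<exists>y\<in>Y. V_ball Y dY \<epsilon> y \<in> filter_members Y (filtermap f F)"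
    using x(1) f(1) by (auto simp: V_ball_in_filter_members_iff eventually_filtermap)
qed

lemma V_limit_unique:
  fixes d :: "'a \<Rightarrow> 'a \<Rightarrow> 'v::value_quantale"
  assumes X: "V_space X d" "uniformly_vanishing_asymmetry X d" "V_separated X d"
    and F: "F \<noteq> bot" "V_converges X d F x" "V_converges X d F y" and "x \<in> X" "y \<in> X"
  shows "x = y"
proof -
  have zero: "d u v = 0"
    if u: "u \<in> X" "V_converges X d F u" and v: "v \<in> X" "V_converges X d F v" for u v
  proof (rule eq_zero_if_le_well_above)
    fix \<epsilon> :: 'v assume "\<epsilon> \<succ> 0"
    then obtain \<eta> where \<eta>: "\<eta> \<succ> 0" "\<eta> + \<eta> \<le> \<epsilon>"
      using well_above_zero_half by blast
    obtain \<delta> where \<delta>: "\<delta> \<succ> 0" "\<And>x y. x \<in> X \<Longrightarrow> y \<in> X \<Longrightarrow> d y x \<le> \<delta> \<Longrightarrow> d x y \<le> \<eta>"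
      using uniformly_vanishing_asymmetryE[OF X(2) \<eta>(1)] by blast
    have "\<forall>\<^sub>F w in F. w \<in> X \<and> d u w \<le> \<eta>" "\<forall>\<^sub>F w in F. w \<in> X \<and> d v w \<le> \<delta>"
      using u(2) v(2) \<eta>(1) \<delta>(1) unfolding V_converges_iff by blast+
    then have "\<forall>\<^sub>F w in F. (w \<in> X \<and> d u w \<le> \<eta>) \<and> (w \<in> X \<and> d v w \<le> \<delta>)"
      by (rule eventually_conj)
    then obtain w where "w \<in> X" "d u w \<le> \<eta>" "d v w \<le> \<delta>"
      using F(1) eventually_happens by blast
    then have "d u v \<le> d u w + d w v" "d u w + d w v \<le> \<eta> + \<eta>"
      using V_spaceD(2)[OF X(1)] u(1) v(1) \<delta>(2) by (auto intro: vq_add_mono)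
    then show "d u v \<le> \<epsilon>"
      using \<eta>(2) by (meson order_trans)
  qed
  show ?thesis
    using X(3) F(2,3) \<open>x \<in> X\<close> \<open>y \<in> X\<close> zero[of x y] zero[of y x] by (simp add: V_separated_def)
qed

section \<open>The embedding into the completion\<close>

lemma V_embedding_converges: "V_converges X d (V_embedding X d x) x"
  using le_V_embedding_iff[of "V_embedding X d x" X d x] by simp

lemma in_member_V_embedding:
  assumes "V_space X d" "x \<in> X" "A \<in> filter_members X (V_embedding X d x)"
  shows "x \<in> A"
proof -
  have "V_converges X d (principal {x}) x"
    using assms(1,2) by (simp add: V_converges_iff eventually_principal V_spaceD)
  then have "principal {x} \<le> V_embedding X d x"
    using assms(2) by (simp add: le_V_embedding_iff)
  then have "eventually (\<lambda>y. y \<in> A) (principal {x})"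
    using assms(3) by (auto simp: filter_members_def le_filter_def)
  then show ?thesis
    by (simp add: eventually_principal)
qed

lemma V_embedding_inj:
  fixes d :: "'a \<Rightarrow> 'a \<Rightarrow> 'v::value_quantale"
  assumes "V_space X d" "V_separated X d" "x \<in> X" "y \<in> X"
    and "V_embedding X d x = V_embedding X d y"
  shows "x = y"
proof -
  have zero: "d u v = 0"
    if "u \<in> X" "v \<in> X" "V_embedding X d u = V_embedding X d v" for u v
  proof (rule eq_zero_if_le_well_above)
    fix \<epsilon> :: 'v assume "\<epsilon> \<succ> 0"
    then have "V_ball X d \<epsilon> u \<in> filter_members X (V_embedding X d v)"
      using V_embedding_converges[of X d u] that(3) by (simp add: V_converges_def)
    then show "d u v \<le> \<epsilon>"
      using in_member_V_embedding[OF assms(1) that(2)] by (auto simp: V_ball_def)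
  qed
  show ?thesis
    using assms(2-5) zero[of x y] zero[of y x] by (simp add: V_separated_def)
qed

text \<open>
  Minimality holds because a Cauchy filter whose members all belong to the ball filter of \<open>x\<close>
  converges to \<open>x\<close>: its small members contain \<open>x\<close>, hence lie in small balls around \<open>x\<close>.
\<close>

lemma V_embedding_in_completion:
  assumes X: "V_space X d" "uniformly_vanishing_asymmetry X d" and x: "x \<in> X"
  shows "V_embedding X d x \<in> V_completion X d"
proof -
  let ?N = "V_embedding X d x"
  have N_le: "?N \<le> principal X"
    using le_V_embedding_iff[of ?N X d x] by simp
  have Cauchy: "V_Cauchy X d ?N"
    using N_le x V_embedding_converges[of X d x] by (auto simp: V_Cauchy_def V_converges_def)
  have "G \<le> ?N" if G: "V_Cauchy X d G" and "?N \<le> G" for G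
  proof -
    have G_le: "G \<le> principal X"
      using G by (simp add: V_Cauchy_def)
    have "\<forall>\<^sub>F y in G. y \<in> X \<and> d x y \<le> \<epsilon>" if "\<epsilon> \<succ> 0" for \<epsilon>
    proof -
      obtain A where A: "A \<in> filter_members X G" "\<And>s t. s \<in> A \<Longrightarrow> t \<in> A \<Longrightarrow> d s t \<le> \<epsilon>"
        using V_Cauchy_small_member[OF X G \<open>\<epsilon> \<succ> 0\<close>] by blast
      have "A \<in> filter_members X ?N"
        using A(1) \<open>?N \<le> G\<close> filter_le_iff_members[OF N_le G_le] by blast
      then have "x \<in> A"
        by (rule in_member_V_embedding[OF X(1) x])
      have "\<forall>\<^sub>F y in G. y \<in> A" "A \<subseteq> X"
        using A(1) by (auto simp: filter_members_def)
      then show ?thesis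
        using A(2) \<open>x \<in> A\<close> by (auto elim: eventually_mono)
    qed
    then show ?thesis
      using G_le by (simp add: le_V_embedding_iff V_converges_iff)
  qed
  moreover have "?N \<noteq> bot"
    using in_member_V_embedding[OF X(1) x, of "{}"] by (auto simp: filter_members_def)
  ultimately show ?thesis
    using Cauchy by (auto simp: V_completion_def V_minimal_Cauchy_def less_le_not_le)
qed

lemma V_completionD:
  assumes "G \<in> V_completion X d"
  shows "V_Cauchy X d G" "G \<noteq> bot"
  using assms by (auto simp: V_completion_def V_minimal_Cauchy_def)

text \<open>
  This is the density of \<open>X\<close> in its completion: every member of \<open>G\<close> meets a member of diameter at
  most \<open>\<delta>\<close>, and every member of the ball filter of \<open>x\<close> contains \<open>x\<close>.
\<close>

lemma V_completion_dist_to_embedding: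
  assumes X: "V_space X d" "uniformly_vanishing_asymmetry X d"
    and G: "V_Cauchy X d G" "G \<noteq> bot" and "\<delta> \<succ> 0"
  shows "\<forall>\<^sub>F x in G. x \<in> X \<and> V_completion_dist X d G (V_embedding X d x) \<le> \<delta>"
proof -
  obtain A where A: "A \<in> filter_members X G" "\<And>s t. s \<in> A \<Longrightarrow> t \<in> A \<Longrightarrow> d s t \<le> \<delta>"
    using V_Cauchy_small_member[OF X G(1) \<open>\<delta> \<succ> 0\<close>] by blast
  have ev_A: "\<forall>\<^sub>F x in G. x \<in> A" and "A \<subseteq> X"
    using A(1) by (auto simp: filter_members_def)
  have "V_completion_dist X d G (V_embedding X d x) \<le> \<delta>" if "x \<in> A" for x
    unfolding V_completion_dist_def
  proof (rule SUP_least, clarify)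
    fix B C assume B: "B \<in> filter_members X G"
      and C: "C \<in> filter_members X (V_embedding X d x)"
    have "x \<in> C"
      using in_member_V_embedding[OF X(1) _ C] that \<open>A \<subseteq> X\<close> by blast
    have "\<forall>\<^sub>F s in G. s \<in> A \<and> s \<in> B"
      using ev_A B by (auto simp: filter_members_def intro: eventually_conj)
    then obtain s where "s \<in> A" "s \<in> B"
      using G(2) eventually_happens by blast
    then have "(INF (s, t) \<in> B \<times> C. d s t) \<le> d s x"
      using \<open>x \<in> C\<close> by (intro INF_lower2[of "(s, x)"]) auto
    also have "\<dots> \<le> \<delta>"
      using A(2) \<open>s \<in> A\<close> that by blast
    finally show "(INF (s, t) \<in> B \<times> C. d s t) \<le> \<delta>" .
  qed
  then show ?thesis
    using ev_A \<open>A \<subseteq> X\<close> by (auto elim: eventually_mono)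
qed

section \<open>Extending a uniformly continuous function\<close>

text \<open>
  Whichever limits are chosen, \<open>F G\<close> is near \<open>f s\<close> for \<open>s\<close> in a member of \<open>G\<close>, and \<open>F H\<close> is near
  \<open>f t\<close> for \<open>t\<close> in a member of \<open>H\<close>. The distance from \<open>G\<close> to \<open>H\<close> bounds the infimum of \<open>dX s t\<close> over
  these two members, and interpolation provides one pair \<open>s\<close>, \<open>t\<close> at small distance.
\<close>

lemma V_uniformly_continuous_limit_choice:
  fixes dX :: "'a \<Rightarrow> 'a \<Rightarrow> 'v::value_quantale" and dY :: "'b \<Rightarrow> 'b \<Rightarrow> 'v"
  assumes Y: "V_space Y dY" "uniformly_vanishing_asymmetry Y dY"
    and f: "f \<in> X \<rightarrow> Y" "V_uniformly_continuous X dX dY f"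
    and \<C>: "\<And>G. G \<in> \<C> \<Longrightarrow> G \<le> principal X"
    and F: "F \<in> \<C> \<rightarrow> Y" "\<And>G. G \<in> \<C> \<Longrightarrow> V_converges Y dY (filtermap f G) (F G)"
  shows "V_uniformly_continuous \<C> (V_completion_dist X dX) dY F"
  unfolding V_uniformly_continuous_def
proof (intro allI impI)
  fix \<epsilon> :: 'v assume "\<epsilon> \<succ> 0"
  then obtain \<eta> where \<eta>: "\<eta> \<succ> 0" "\<eta> + (\<eta> + \<eta>) \<le> \<epsilon>"
    using well_above_zero_third by blast
  obtain \<theta> where \<theta>: "\<theta> \<succ> 0" "\<And>x y. x \<in> Y \<Longrightarrow> y \<in> Y \<Longrightarrow> dY y x \<le> \<theta> \<Longrightarrow> dY x y \<le> \<eta>"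
    using uniformly_vanishing_asymmetryE[OF Y(2) \<eta>(1)] by blast
  obtain \<gamma> where \<gamma>: "\<gamma> \<succ> 0"
    "\<And>x y. x \<in> X \<Longrightarrow> y \<in> X \<Longrightarrow> dX x y \<le> \<gamma> \<Longrightarrow> dY (f x) (f y) \<le> \<eta>"
    using V_uniformly_continuousE[OF f(2) \<eta>(1)] by blast
  obtain \<delta> where \<delta>: "\<delta> \<succ> 0" "\<gamma> \<succ> \<delta>"
    using well_above_zero_interpolate[OF \<gamma>(1)] .
  have near: "{s \<in> X. dY (F G) (f s) \<le> \<kappa>} \<in> filter_members X G" if "G \<in> \<C>" "\<kappa> \<succ> 0" for G \<kappa>
  proof -
    have "\<forall>\<^sub>F s in G. s \<in> X"
      using \<C>[OF that(1)] by (simp add: le_principal)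
    moreover have "\<forall>\<^sub>F s in G. f s \<in> Y \<and> dY (F G) (f s) \<le> \<kappa>"
      using F(2)[OF that(1)] that(2) by (simp add: V_converges_iff eventually_filtermap)
    ultimately show ?thesis
      by (auto simp: filter_members_def elim: eventually_elim2)
  qed
  have "dY (F G) (F H) \<le> \<epsilon>"
    if G: "G \<in> \<C>" and H: "H \<in> \<C>" and dist: "V_completion_dist X dX G H \<le> \<delta>" for G H
  proof -
    let ?A = "{s \<in> X. dY (F G) (f s) \<le> \<eta>}" and ?B = "{t \<in> X. dY (F H) (f t) \<le> \<theta>}"
    have "(INF (s, t) \<in> ?A \<times> ?B. dX s t) \<le> V_completion_dist X dX G H"
      unfolding V_completion_dist_def
      using near[OF G \<eta>(1)] near[OF H \<theta>(1)] by (intro SUP_upper2[of "(?A, ?B)"]) auto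
    then have "(INF (s, t) \<in> ?A \<times> ?B. dX s t) \<le> \<delta>"
      using dist by (rule order_trans)
    from well_aboveD[OF \<delta>(2) this] obtain s t where "s \<in> ?A" "t \<in> ?B" "dX s t \<le> \<gamma>"
      by auto
    then have st: "s \<in> X" "t \<in> X" "dX s t \<le> \<gamma>" "dY (F G) (f s) \<le> \<eta>" "dY (F H) (f t) \<le> \<theta>"
      by auto
    have mem: "F G \<in> Y" "F H \<in> Y" "f s \<in> Y" "f t \<in> Y"
      using F(1) f(1) G H st(1,2) by auto
    have "dY (f s) (F H) \<le> dY (f s) (f t) + dY (f t) (F H)"
      using V_spaceD(2)[OF Y(1)] mem by blast
    also have "\<dots> \<le> \<eta> + \<eta>"
      using \<gamma>(2) \<theta>(2) st mem by (intro vq_add_mono) auto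
    finally have "dY (f s) (F H) \<le> \<eta> + \<eta>" .
    with st(4) have "dY (F G) (f s) + dY (f s) (F H) \<le> \<eta> + (\<eta> + \<eta>)"
      by (rule vq_add_mono)
    then show ?thesis
      using V_spaceD(2)[OF Y(1)] mem \<eta>(2) by (meson order_trans)
  qed
  then show "\<exists>\<delta>. \<delta> \<succ> 0 \<and> (\<forall>G\<in>\<C>. \<forall>H\<in>\<C>. V_completion_dist X dX G H \<le> \<delta> \<longrightarrow> dY (F G) (F H) \<le> \<epsilon>)"
    using \<delta>(1) by blast
qed

lemma V_converges_filtermap_embedding:
  fixes dX :: "'a \<Rightarrow> 'a \<Rightarrow> 'v::value_quantale" and dY :: "'b \<Rightarrow> 'b \<Rightarrow> 'v"
  assumes f: "f \<in> X \<rightarrow> Y" "V_uniformly_continuous X dX dY f" and x: "x \<in> X"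
  shows "V_converges Y dY (filtermap f (V_embedding X dX x)) (f x)"
  unfolding V_converges_iff
proof (intro allI impI)
  fix \<epsilon> :: 'v assume "\<epsilon> \<succ> 0"
  then obtain \<delta> where \<delta>: "\<delta> \<succ> 0"
    "\<And>x y. x \<in> X \<Longrightarrow> y \<in> X \<Longrightarrow> dX x y \<le> \<delta> \<Longrightarrow> dY (f x) (f y) \<le> \<epsilon>"
    using V_uniformly_continuousE[OF f(2)] by blast
  have "\<forall>\<^sub>F y in V_embedding X dX x. y \<in> X \<and> dX x y \<le> \<delta>"
    using V_embedding_converges[of X dX x] \<delta>(1) by (simp add: V_converges_iff)
  then show "\<forall>\<^sub>F y in filtermap f (V_embedding X dX x). y \<in> Y \<and> dY (f x) y \<le> \<epsilon>"
    unfolding eventually_filtermap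
    by (rule eventually_mono) (use x f(1) \<delta>(2) in auto)
qed

text \<open>
  Near \<open>G\<close> the values of \<open>F\<close> at ball filters are close to \<open>F G\<close>, and these values are the values
  of \<open>f\<close>.
\<close>

lemma V_extension_value_is_limit:
  fixes dX :: "'a \<Rightarrow> 'a \<Rightarrow> 'v::value_quantale" and dY :: "'b \<Rightarrow> 'b \<Rightarrow> 'v"
  assumes X: "V_space X dX" "uniformly_vanishing_asymmetry X dX" and f: "f \<in> X \<rightarrow> Y"
    and F: "V_uniformly_continuous (V_completion X dX) (V_completion_dist X dX) dY F"
      "\<And>x. x \<in> X \<Longrightarrow> F (V_embedding X dX x) = f x"
    and G: "G \<in> V_completion X dX"
  shows "V_converges Y dY (filtermap f G) (F G)"
  unfolding V_converges_iff
proof (intro allI impI)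
  fix \<epsilon> :: 'v assume "\<epsilon> \<succ> 0"
  then obtain \<delta> where \<delta>: "\<delta> \<succ> 0"
    "\<And>G H. G \<in> V_completion X dX \<Longrightarrow> H \<in> V_completion X dX \<Longrightarrow>
      V_completion_dist X dX G H \<le> \<delta> \<Longrightarrow> dY (F G) (F H) \<le> \<epsilon>"
    using V_uniformly_continuousE[OF F(1)] by blast
  have "\<forall>\<^sub>F x in G. x \<in> X \<and> V_completion_dist X dX G (V_embedding X dX x) \<le> \<delta>"
    by (rule V_completion_dist_to_embedding[OF X V_completionD[OF G] \<delta>(1)])
  then show "\<forall>\<^sub>F y in filtermap f G. y \<in> Y \<and> dY (F G) y \<le> \<epsilon>"
    unfolding eventually_filtermap
  proof (rule eventually_mono)
    fix x assume "x \<in> X \<and> V_completion_dist X dX G (V_embedding X dX x) \<le> \<delta>"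
    then have "x \<in> X" "dY (F G) (F (V_embedding X dX x)) \<le> \<epsilon>"
      using \<delta>(2)[OF G V_embedding_in_completion[OF X]] by auto
    then show "f x \<in> Y \<and> dY (F G) (f x) \<le> \<epsilon>"
      using F(2) f by auto
  qed
qed

theorem corollary4p22:
  fixes X :: "'x set" and dX :: "'x \<Rightarrow> 'x \<Rightarrow> 'v::value_quantale"
    and Y :: "'y set" and dY :: "'y \<Rightarrow> 'y \<Rightarrow> 'v"
    and f :: "'x \<Rightarrow> 'y"
  assumes "V_space X dX" and "V_separated X dX" and "uniformly_vanishing_asymmetry X dX"
    and "V_space Y dY" and "uniformly_vanishing_asymmetry Y dY" and "V_Cauchy_complete Y dY"
    and "f \<in> X \<rightarrow> Y" and "V_uniformly_continuous X dX dY f"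
  shows "(\<exists>F. F \<in> V_completion X dX \<rightarrow>\<^sub>E Y \<and>
            V_uniformly_continuous (V_completion X dX) (V_completion_dist X dX) dY F \<and>
            (\<forall>x\<in>X. F (V_embedding X dX x) = f x)) \<and>
         (V_separated Y dY \<longrightarrow>
          (\<exists>!F. F \<in> V_completion X dX \<rightarrow>\<^sub>E Y \<and>
            V_uniformly_continuous (V_completion X dX) (V_completion_dist X dX) dY F \<and>
            (\<forall>x\<in>X. F (V_embedding X dX x) = f x)))"
proof -
  note X = assms(1,3) and Y = assms(4,5) and f = assms(7,8)
  let ?C = "V_completion X dX"
  let ?ext = "\<lambda>F. F \<in> ?C \<rightarrow>\<^sub>E Y \<and>
    V_uniformly_continuous ?C (V_completion_dist X dX) dY F \<and>
    (\<forall>x\<in>X. F (V_embedding X dX x) = f x)"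
  have "\<exists>y\<in>Y. V_converges Y dY (filtermap f G) y \<and> (\<forall>x\<in>X. G = V_embedding X dX x \<longrightarrow> y = f x)"
    if G: "G \<in> ?C" for G
  proof (cases "\<exists>x\<in>X. G = V_embedding X dX x")
    case True
    then obtain x where "x \<in> X" "G = V_embedding X dX x"
      by blast
    then show ?thesis
      using V_converges_filtermap_embedding[OF f] V_embedding_inj[OF assms(1,2)] f(1) by blast
  next
    case False
    have "V_Cauchy Y dY (filtermap f G)" "filtermap f G \<noteq> bot"
      using V_completionD[OF G] V_Cauchy_filtermap[OF _ f] by (auto simp: filtermap_bot_iff)
    then show ?thesis
      using assms(6) False unfolding V_Cauchy_complete_def by blast
  qed
  then obtain L where L: "\<And>G. G \<in> ?C \<Longrightarrow> L G \<in> Y \<and> V_converges Y dY (filtermap f G) (L G) \<and>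
      (\<forall>x\<in>X. G = V_embedding X dX x \<longrightarrow> L G = f x)"
    by metis
  let ?L = "restrict L ?C"
  have "V_uniformly_continuous ?C (V_completion_dist X dX) dY ?L"
  proof (rule V_uniformly_continuous_limit_choice[OF Y f])
    show "G \<le> principal X" if "G \<in> ?C" for G
      using V_completionD(1)[OF that] by (simp add: V_Cauchy_def)
  qed (use L in auto)
  then have ext: "?ext ?L"
    using L V_embedding_in_completion[OF X] by auto
  have unique: "F = F'" if "V_separated Y dY" "?ext F" "?ext F'" for F F'
  proof (rule PiE_ext)
    show "F \<in> ?C \<rightarrow>\<^sub>E Y" "F' \<in> ?C \<rightarrow>\<^sub>E Y"
      using that by blast+
    fix G assume G: "G \<in> ?C"
    have lim: "V_converges Y dY (filtermap f G) (H G)" if "?ext H" for H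
      using that by (intro V_extension_value_is_limit[OF X f(1) _ _ G]) auto
    show "F G = F' G"
    proof (rule V_limit_unique[OF Y \<open>V_separated Y dY\<close>])
      show "filtermap f G \<noteq> bot"
        using V_completionD(2)[OF G] by (simp add: filtermap_bot_iff)
    qed (use lim that G in \<open>auto simp: PiE_iff\<close>)
  qed
  show ?thesis
    using ext unique by blast
qed

end
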